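(* Let $\mu\in BC(\mathbb{R},\mathbb{C})$ be an ergodic function with mean $M(\mu)$ such that $\mathrm{Re}(M(\mu))\neq 0$, and let $\alpha>0$ be a real number. Then there exist two positive constants $T_0$ (big enough) and $c$ such that the following two assertions are valid. (i) If $\mathrm{Re}(M(\mu))\in\,]-\infty,-\alpha[$, then $$\mathrm{Re}\left(\int_s^t\mu(r)\,dr\right)<-\alpha(t-s)\quad\text{for } t-s>T_0,$$ $$\left|\exp\left(\int_s^t\mu(r)\,dr\right)\right|\le c\exp(-\alpha(t-s))\quad\text{for all }(t,s)\in\mathbb{R}^2\text{ such that } t\ge s\ge 0.$$ (ii) If $\mathrm{Re}(M(\mu))\in\,]\alpha,\infty[$, then $$\mathrm{Re}\left(\int_s^t\mu(r)\,dr\right)<\alpha(t-s)\quad\text{for } s-t>T_0,$$ $$\left|\exp\left(\int_s^t\mu(r)\,dr\right)\right|\le c\exp(\alpha(t-s))\quad\text{for all }(t,s)\in\mathbb{R}^2\text{ such that } s\ge t\ge 0.$$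
   Context: $BC(\mathbb{R},V)$ denotes the Banach space of bounded continuous functions from $\mathbb{R}$ to the Banach space $V$ with the sup norm. A function $f\in BC(\mathbb{R},V)$ is called ergodic if the limit $$M(f)=\lim_{T\to\infty}\frac{1}{2T}\int_{-T+\xi}^{T+\xi}f(s)\,ds$$ exists uniformly with respect to $\xi\in\mathbb{R}$ and its value is independent of $\xi$; $M(f)$ is called the mean of $f$. *)

theory Defs
  imports "HOL-Analysis.Analysis"
begin

text \<open>The space of bounded continuous functions \<open>BC(\<real>, V)\<close> is \<^typ>\<open>real \<Rightarrow>\<^sub>C 'v\<close>, with the sup norm.
  The average over \<open>[\<xi> - T, \<xi> + T]\<close> uses the Henstock--Kurzweil integral, which, unlike the Bochner
  integral of the library, does not require \<open>V\<close> to be separable.\<close>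

definition average :: "(real \<Rightarrow>\<^sub>C 'v::banach) \<Rightarrow> real \<Rightarrow> real \<Rightarrow> 'v" where
  "average f T \<xi> = (1 / (2 * T)) *\<^sub>R integral {- T + \<xi>..T + \<xi>} (apply_bcontfun f)"

text \<open>The limit function is the constant \<open>\<lambda>_. m\<close>: its value does not depend on \<open>\<xi>\<close>.\<close>

definition has_mean :: "(real \<Rightarrow>\<^sub>C 'v::banach) \<Rightarrow> 'v \<Rightarrow> bool" where
  "has_mean f m \<longleftrightarrow> uniform_limit UNIV (average f) (\<lambda>_. m) at_top"

definition ergodic :: "(real \<Rightarrow>\<^sub>C 'v::banach) \<Rightarrow> bool" where
  "ergodic f \<longleftrightarrow> (\<exists>m. has_mean f m)"

text \<open>Meaningful only for ergodic \<open>f\<close>, where the limit is unique.\<close>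

definition mean :: "(real \<Rightarrow>\<^sub>C 'v::banach) \<Rightarrow> 'v" where
  "mean f = (THE m. has_mean f m)"

lemma has_mean_unique:
  assumes "has_mean f m" and "has_mean f m'"
  shows "m = m'"
proof -
  have "((\<lambda>T. average f T 0) \<longlongrightarrow> m) at_top" "((\<lambda>T. average f T 0) \<longlongrightarrow> m') at_top"
    using assms unfolding has_mean_def by (auto intro: tendsto_uniform_limitI)
  then show ?thesis
    by (intro tendsto_unique[OF trivial_limit_at_top_linorder])
qed

lemma has_mean_mean: "ergodic f \<Longrightarrow> has_mean f (mean f)"
  unfolding ergodic_def mean_def by (metis has_mean_unique theI)

end

theory Submission
  imports Defs
begin

text \<open>On an interval of length \<open>2T\<close>, the integral of \<open>\<mu>\<close> is \<open>2T\<close> times an average, hence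
  \<open>2T (M(\<mu>) + o(1))\<close> uniformly in the position of the interval. With the gap between
  \<open>\<bar>Re (M(\<mu>))\<bar>\<close> and \<open>\<alpha>\<close> as tolerance, this settles long intervals; on the short ones the
  integral is bounded by the sup norm of \<open>\<mu>\<close>, and the constant \<open>c\<close> absorbs it.\<close>

text \<open>The interval from \<open>a\<close> to \<open>b\<close> has centre
  \<open>(a + b) / 2\<close> and half-length \<open>(b - a) / 2\<close>. Uniformity of the limit in
  the centre makes one threshold valid for all positions; multiplying by the length turns the
  average into the integral.\<close>

lemma has_mean_integral_bound:
  fixes f :: "real \<Rightarrow>\<^sub>C 'v::banach"
  assumes "has_mean f m" and "e > 0"
  obtains T where "T > 0"
    and "\<And>a b. b - a > T \<Longrightarrow> norm (integral {a..b} f - (b - a) *\<^sub>R m) < e * (b - a)"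
proof -
  from assms have "\<forall>\<^sub>F T in at_top. \<forall>\<xi>. dist (average f T \<xi>) m < e"
    unfolding has_mean_def uniform_limit_iff by simp
  then obtain T\<^sub>1 where T\<^sub>1: "dist (average f T \<xi>) m < e" if "T \<ge> T\<^sub>1" for T \<xi>
    unfolding eventually_at_top_linorder by blast
  \<comment> \<open>The bound \<open>2 * T\<^sub>1\<close> makes the half-length reach
    \<open>T\<^sub>1\<close>; the 1 keeps the length positive even if \<open>T\<^sub>1\<close> is
    negative.\<close>
  have "norm (integral {a..b} f - (b - a) *\<^sub>R m) < e * (b - a)"
    if ab: "b - a > max 1 (2 * T\<^sub>1)" for a b
  proof -
    have pos: "b - a > 0"
      using ab by simp
    have "- ((b - a) / 2) + (a + b) / 2 = a" "(b - a) / 2 + (a + b) / 2 = b"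
      "2 * ((b - a) / 2) = b - a"
      by (simp_all add: field_simps)
    then have "average f ((b - a) / 2) ((a + b) / 2) = (1 / (b - a)) *\<^sub>R integral {a..b} f"
      unfolding average_def by (simp only:)
    moreover have "dist (average f ((b - a) / 2) ((a + b) / 2)) m < e"
      using ab by (intro T\<^sub>1) simp
    ultimately have "norm ((1 / (b - a)) *\<^sub>R integral {a..b} f - m) < e"
      by (simp add: dist_norm)
    then have "(b - a) * norm ((1 / (b - a)) *\<^sub>R integral {a..b} f - m) < (b - a) * e"
      using pos by simp
    moreover have "integral {a..b} f - (b - a) *\<^sub>R m
        = (b - a) *\<^sub>R ((1 / (b - a)) *\<^sub>R integral {a..b} f - m)"
      using pos by (simp add: scaleR_diff_right)
    ultimately show ?thesis
      using pos by (simp add: mult.commute)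
  qed
  then show thesis
    by (intro that[of "max 1 (2 * T\<^sub>1)"]) auto
qed

text \<open>Links the oriented Lebesgue integral of the theorem to the Henstock-Kurzweil integral in
  \<open>average\<close>: a continuous function on a compact interval is integrable in both
  senses.\<close>

lemma interval_lebesgue_integral_bcontfun:
  fixes f :: "real \<Rightarrow>\<^sub>C 'v::euclidean_space"
  assumes "a \<le> b"
  shows "(LBINT r=ereal a..ereal b. f r) = integral {a..b} f"
proof -
  have "continuous_on {a..b} f"
    using continuous_on_subset by blast
  then have "set_integrable lborel {a..b} f"
    by (rule borel_integrable_atLeastAtMost')
  then show ?thesis
    using assms by (intro interval_integral_eq_integral)
qed

lemma norm_integral_bcontfun_le:
  fixes f :: "real \<Rightarrow>\<^sub>C 'v::banach"
  assumes "a \<le> b"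
  shows "norm (integral {a..b} f) \<le> norm f * (b - a)"
  using assms by (intro integral_bound) (auto intro: norm_bounded)

text \<open>The modulus of \<open>exp z\<close> is \<open>exp (Re z)\<close>, so bounding the real
  part suffices. \<open>I\<close> stays abstract so that it can stand for the integral or for its
  negative.\<close>

lemma cmod_exp_le_of_decay:
  assumes long: "\<And>a b. b - a > T \<Longrightarrow> Re (I a b) < - \<alpha> * (b - a)"
    and short: "\<And>a b. a \<le> b \<Longrightarrow> cmod (I a b) \<le> B * (b - a)"
    and "B \<ge> 0" "\<alpha> \<ge> 0" "T \<ge> 0" "a \<le> b"
  shows "cmod (exp (I a b)) \<le> exp ((B + \<alpha>) * T) * exp (- \<alpha> * (b - a))"
proof -
  have "Re (I a b) \<le> (B + \<alpha>) * T + - \<alpha> * (b - a)"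
  proof (cases "b - a > T")
    case True
    moreover have "(B + \<alpha>) * T \<ge> 0"
      using assms by simp
    ultimately show ?thesis
      using long[where a = a and b = b] by linarith
  next
    case False
    \<comment> \<open>Write \<open>B * (b - a)\<close> as
      \<open>(B + \<alpha>) * (b - a) - \<alpha> * (b - a)\<close>; the first term is at most
      \<open>(B + \<alpha>) * T\<close> on a short interval.\<close>
    have "Re (I a b) \<le> B * (b - a)"
      using complex_Re_le_cmod short[OF \<open>a \<le> b\<close>] by (rule order_trans)
    moreover have "(B + \<alpha>) * (b - a) \<le> (B + \<alpha>) * T"
      using False assms by (intro mult_left_mono) auto
    ultimately show ?thesis
      by (simp add: algebra_simps)
  qed
  then show ?thesis
    by (simp add: norm_exp_eq_Re flip: exp_add)
qed

theorem lemma2p3: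
  fixes \<mu> :: "real \<Rightarrow>\<^sub>C complex" and \<alpha> :: real
  assumes "ergodic \<mu>"
    and "Re (mean \<mu>) \<noteq> 0"
    and "\<alpha> > 0"
  shows "\<exists>T\<^sub>0 > 0. \<exists>c > 0.
    (Re (mean \<mu>) \<in> {..< - \<alpha>} \<longrightarrow>
      (\<forall>t s :: real. t - s > T\<^sub>0 \<longrightarrow>
        Re (LBINT r=ereal s..ereal t. apply_bcontfun \<mu> r) < - \<alpha> * (t - s)) \<and>
      (\<forall>t s :: real. t \<ge> s \<and> s \<ge> 0 \<longrightarrow>
        cmod (exp (LBINT r=ereal s..ereal t. apply_bcontfun \<mu> r)) \<le> c * exp (- \<alpha> * (t - s)))) \<and>
    (Re (mean \<mu>) \<in> {\<alpha> <..} \<longrightarrow>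
      (\<forall>t s :: real. s - t > T\<^sub>0 \<longrightarrow>
        Re (LBINT r=ereal s..ereal t. apply_bcontfun \<mu> r) < \<alpha> * (t - s)) \<and>
      (\<forall>t s :: real. s \<ge> t \<and> t \<ge> 0 \<longrightarrow>
        cmod (exp (LBINT r=ereal s..ereal t. apply_bcontfun \<mu> r)) \<le> c * exp (\<alpha> * (t - s))))"
proof (cases "\<bar>Re (mean \<mu>)\<bar> > \<alpha>")
  case False
  then have "Re (mean \<mu>) \<notin> {..< - \<alpha>}" "Re (mean \<mu>) \<notin> {\<alpha> <..}"
    by auto
  then show ?thesis
    \<comment> \<open>Both implications are vacuous here, so any positive constants do.\<close>
    by (intro exI[of _ 1] conjI) auto
next
  case True
  define m where "m = mean \<mu>"
  define B where "B = norm \<mu>"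
  define I where "I a b = integral {a..b} \<mu>" for a b
  have "\<bar>Re m\<bar> - \<alpha> > 0"
    using True by (simp add: m_def)
  then obtain T where T: "T > 0"
    and I: "\<And>a b. b - a > T \<Longrightarrow> cmod (I a b - (b - a) *\<^sub>R m) < (\<bar>Re m\<bar> - \<alpha>) * (b - a)"
    using has_mean_integral_bound[OF has_mean_mean[OF assms(1)]] unfolding I_def m_def by metis
  have Re_I: "\<bar>Re (I a b) - (b - a) * Re m\<bar> < (\<bar>Re m\<bar> - \<alpha>) * (b - a)" if "b - a > T" for a b
    using abs_Re_le_cmod[of "I a b - (b - a) *\<^sub>R m"] I[OF that] by simp
  have B: "cmod (I a b) \<le> B * (b - a)" if "a \<le> b" for a b
    using norm_integral_bcontfun_le[OF that] by (simp add: I_def B_def)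
  have LBINT_forward: "(LBINT r=ereal a..ereal b. \<mu> r) = I a b" if "a \<le> b" for a b
    using interval_lebesgue_integral_bcontfun[OF that] by (simp add: I_def)
  have LBINT_backward: "(LBINT r=ereal b..ereal a. \<mu> r) = - I a b" if "a \<le> b" for a b
    using LBINT_forward[OF that] that
    \<comment> \<open>Reversing the limits flips the sign only if they differ; for equal limits both
      sides vanish.\<close>
    by (cases "a = b") (simp_all add: interval_lebesgue_integral_def I_def)
  have B0: "B \<ge> 0"
    by (simp add: B_def)
  \<comment> \<open>Here \<open>\<bar>Re m\<bar> = - Re m\<close>, so in the upper estimate from
    \<open>Re_I\<close> the terms in \<open>Re m\<close> cancel.\<close>
  have neg: "Re (I a b) < - \<alpha> * (b - a)" if "Re m < - \<alpha>" "b - a > T" for a b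
    using Re_I[OF that(2)] that(1) assms(3) by (simp add: algebra_simps abs_if split: if_splits)
  \<comment> \<open>The same cancellation, now in the lower estimate with
    \<open>\<bar>Re m\<bar> = Re m\<close>.\<close>
  have pos: "Re (- I a b) < - \<alpha> * (b - a)" if "Re m > \<alpha>" "b - a > T" for a b
    using Re_I[OF that(2)] that(1) assms(3) by (simp add: algebra_simps abs_if split: if_splits)
  define c where "c = exp ((B + \<alpha>) * T)"
  show ?thesis
    unfolding m_def[symmetric]
  proof (rule exI[of _ T], intro conjI exI[of _ c] impI allI)
    fix t s :: real
    show "T > 0" "c > 0"
      using T by (simp_all add: c_def)
    show "Re (LBINT r=ereal s..ereal t. \<mu> r) < - \<alpha> * (t - s)"
      if "Re m \<in> {..< - \<alpha>}" "t - s > T"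
      using neg[where a = s and b = t] that T by (simp add: LBINT_forward)
    show "cmod (exp (LBINT r=ereal s..ereal t. \<mu> r)) \<le> c * exp (- \<alpha> * (t - s))"
      if "Re m \<in> {..< - \<alpha>}" "t \<ge> s \<and> s \<ge> 0"
      using cmod_exp_le_of_decay[of T I \<alpha> B s t] neg B B0 T assms(3) that
      by (simp add: LBINT_forward c_def)
    show "Re (LBINT r=ereal s..ereal t. \<mu> r) < \<alpha> * (t - s)"
      if "Re m \<in> {\<alpha> <..}" "s - t > T"
      using pos[where a = t and b = s] that T by (simp add: LBINT_backward algebra_simps)
    show "cmod (exp (LBINT r=ereal s..ereal t. \<mu> r)) \<le> c * exp (\<alpha> * (t - s))"
      if "Re m \<in> {\<alpha> <..}" "s \<ge> t \<and> t \<ge> 0"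
    proof -
      \<comment> \<open>Since \<open>t \<le> s\<close>, the integral from \<open>s\<close> to
        \<open>t\<close> is \<open>- I t s\<close>, which decays by \<open>pos\<close>; the same
        \<open>c\<close> therefore serves both assertions.\<close>
      have "cmod (exp (- I t s)) \<le> exp ((B + \<alpha>) * T) * exp (- \<alpha> * (s - t))"
        using pos B B0 T assms(3) that
        by (intro cmod_exp_le_of_decay[where I = "\<lambda>a b. - I a b"]) auto
      moreover have "- \<alpha> * (s - t) = \<alpha> * (t - s)"
        by (simp add: algebra_simps)
      ultimately show ?thesis
        using that by (simp add: LBINT_backward c_def)
    qed
  qed
qed

end
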